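(* Let $a>0$ and $Y_0\in F^2_{a/2}$. The solution of the heat Cauchy problem associated to the complex Euler operator $E^a_z=-2az\frac{\partial}{\partial z}-a$, $$\begin{cases} E^a_z Y(t,z)=\frac{\partial}{\partial t}Y(t,z), & (t,z)\in(0,\infty)\times\mathbb{C},\\ Y(0,z)=Y_0(z), & z\in\mathbb{C},\end{cases}$$ is given by the formula $$Y(t,z)=e^{-at}\,Y_0(e^{-2at}z).$$
   Context: For $\alpha>0$, $d\lambda_\alpha(z)=\frac{\alpha}{\pi}e^{-\alpha|z|^2}dz$ denotes the Gaussian measure on $\mathbb{C}$ ($dz$ being Lebesgue area measure), and the Fock space $F^2_\alpha$ is the space of all entire functions belonging to $L^2(\mathbb{C},d\lambda_\alpha)$. Thus $F^2_{a/2}$ is the Fock space with parameter $\alpha=a/2$. Here $\frac{\partial}{\partial z}$ is the complex derivative in $z$. *)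

theory Defs
  imports "HOL-Complex_Analysis.Complex_Analysis"
begin

definition gaussian_measure :: "real \<Rightarrow> complex measure" where
  "gaussian_measure \<alpha> =
     density lborel (\<lambda>z. ennreal (\<alpha> / pi * exp (- \<alpha> * (norm z)\<^sup>2)))"

text \<open>Entire functions are Borel measurable, so integrability of the squared modulus is
  exactly membership in \<open>L\<^sup>2\<close>.\<close>

definition fock_space :: "real \<Rightarrow> (complex \<Rightarrow> complex) set" where
  "fock_space \<alpha> =
     {f. f holomorphic_on UNIV \<and> integrable (gaussian_measure \<alpha>) (\<lambda>z. (norm (f z))\<^sup>2)}"

definition euler_op :: "real \<Rightarrow> (complex \<Rightarrow> complex) \<Rightarrow> complex \<Rightarrow> complex" where
  "euler_op a f z = - 2 * of_real a * z * deriv f z - of_real a * f z"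

text \<open>Classical solutions. Holomorphy of each \<open>Y t\<close> is what makes the complex
  \<open>z\<close>-derivative meaningful (\<^const>\<open>deriv\<close> is total), and continuity in time up to \<open>t = 0\<close> is
  what ties the initial value to the equation, which only holds for \<open>t > 0\<close>. No joint
  regularity in \<open>(t, z)\<close> and no growth in \<open>z\<close> is required. Values at \<open>t < 0\<close> are
  irrelevant.\<close>

definition heat_solution ::
  "real \<Rightarrow> (complex \<Rightarrow> complex) \<Rightarrow> (real \<Rightarrow> complex \<Rightarrow> complex) \<Rightarrow> bool" where
  "heat_solution a Y0 Y \<longleftrightarrow>
     (\<forall>t>0. Y t holomorphic_on UNIV) \<and>
     (\<forall>z. continuous_on {0..} (\<lambda>t. Y t z)) \<and>
     (\<forall>t>0. \<forall>z. ((\<lambda>s. Y s z) has_vector_derivative euler_op a (Y t) z) (at t)) \<and>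
     (\<forall>z. Y 0 z = Y0 z)"

end

theory Submission imports Defs begin

text \<open>
  That the formula defines a solution is a computation; the substance is uniqueness. The curves
  \<open>t \<mapsto> e\<^sup>2\<^sup>a\<^sup>t w\<close> are the characteristics of the equation, and along
  them \<open>Z(t, w) = e\<^sup>a\<^sup>t Y(t, e\<^sup>2\<^sup>a\<^sup>t w)\<close> formally satisfies
  \<open>\<partial>Z/\<partial>t = 0\<close>. If \<open>Z\<close> does not depend on \<open>t > 0\<close>, letting \<open>t \<rightarrow> 0\<close>
  identifies it with \<open>Y\<^sub>0\<close>, and solving for \<open>Y\<close> yields the formula.

  The chain rule behind \<open>\<partial>Z/\<partial>t = 0\<close> needs regularity of \<open>Y\<close> in both variables jointly,
  whereas a solution is only separately regular. Local boundedness suffices: if \<open>Y\<close> is bounded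
  for \<open>t\<close> in an open interval and \<open>z\<close> in a disc about \<open>0\<close>, Cauchy's estimates make
  \<open>\<partial>Y/\<partial>z\<close> jointly continuous there (\<open>continuous_on_deriv_of_bounded_family\<close>), so
  \<open>Z(t, w)\<close> is constant in \<open>t\<close> for small \<open>w\<close>, and for all \<open>w\<close> by the identity theorem
  (\<open>along_flow_constant_if_bounded\<close>).

  Local boundedness is obtained from Baire's theorem. Call a time irregular if \<open>Z\<close> is not constant
  near it. The set \<open>P\<close> of irregular times is relatively closed in \<open>(0, \<infinity>)\<close>. If it is nonempty,
  Osgood's argument, applied on \<open>P\<close> itself, gives an open interval \<open>I\<close> meeting \<open>P\<close> such that
  \<open>Y\<close> is bounded on the unit disc uniformly over the times in \<open>I \<inter> P\<close>. On each gap of \<open>P\<close> the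
  function \<open>Z\<close> is constant, with the same value at the end points, so that \<open>Y\<close> at a time in the gap is a
  rescaled copy of \<open>Y\<close> at a time in \<open>P\<close>. The bound therefore spreads, on a smaller disc, to all
  times near a point of \<open>I \<inter> P\<close>, which is then not irregular: a contradiction
  (\<open>no_irregular_times\<close>).
\<close>

section \<open>Families of functions with separate regularity\<close>

text \<open>Osgood's form of the uniform boundedness principle: pointwise bounds over \<open>K\<close> are uniform
  on some nonempty relatively open set of parameters.\<close>

lemma uniformly_bounded_on_relatively_open_subset:
  fixes f :: "'a::topological_space \<Rightarrow> 'b \<Rightarrow> 'c::real_normed_vector"
  assumes P: "completely_metrizable_space (top_of_set P)" "P \<noteq> {}"
    and cont: "\<And>z. z \<in> K \<Longrightarrow> continuous_on P (\<lambda>t. f t z)"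
    and bdd: "\<And>t. t \<in> P \<Longrightarrow> \<exists>B. \<forall>z\<in>K. norm (f t z) \<le> B"
  obtains U B where "open U" "U \<inter> P \<noteq> {}"
    "\<And>t z. t \<in> U \<inter> P \<Longrightarrow> z \<in> K \<Longrightarrow> norm (f t z) \<le> B"
proof -
  define A where "A = (\<lambda>n::nat. {t\<in>P. \<forall>z\<in>K. norm (f t z) \<le> real n})"
  have closed_A: "closedin (top_of_set P) (A n)" for n
  proof -
    have "closedin (top_of_set P) {t\<in>P. norm (f t z) \<le> real n}" if "z \<in> K" for z
    proof -
      have "continuous_on P (\<lambda>t. norm (f t z))"
        using cont[OF that] by (intro continuous_intros)
      from continuous_closedin_preimage[OF this closed_atMost, of "real n"]
      show ?thesis by (simp add: vimage_def Int_def)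
    qed
    then have "closedin (top_of_set P) (\<Inter>(insert P ((\<lambda>z. {t\<in>P. norm (f t z) \<le> real n}) ` K)))"
      by (intro closedin_Inter) auto
    moreover have "\<Inter>(insert P ((\<lambda>z. {t\<in>P. norm (f t z) \<le> real n}) ` K)) = A n"
      by (auto simp: A_def)
    ultimately show ?thesis by simp
  qed
  have "\<Union>(range A) = P"
  proof (intro equalityI subsetI)
    fix t assume t: "t \<in> P"
    obtain B where "\<forall>z\<in>K. norm (f t z) \<le> B" using bdd[OF t] by blast
    moreover obtain n where "B \<le> real n" using real_arch_simple by blast
    ultimately have "t \<in> A n" using t unfolding A_def by force
    then show "t \<in> \<Union>(range A)" by blast
  qed (auto simp: A_def)
  then have "top_of_set P interior_of \<Union>(range A) \<noteq> {}"
    using P(2) by (metis interior_of_topspace topspace_euclidean_subtopology)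
  then obtain n where "top_of_set P interior_of A n \<noteq> {}"
    using Baire_category_alt[of "top_of_set P" "range A"] P(1) closed_A by auto
  then obtain V where V: "openin (top_of_set P) V" "V \<noteq> {}" "V \<subseteq> A n"
    using interior_of_subset openin_interior_of by metis
  then obtain U where "open U" "V = P \<inter> U" by (auto simp: openin_open)
  then show thesis using V that[of U "real n"] unfolding A_def by blast
qed

text \<open>The second derivatives are uniformly bounded by Cauchy's estimates. Hence the derivatives are
  Lipschitz in \<open>z\<close>, uniformly in \<open>t\<close>, and are uniform limits in \<open>t\<close> of difference quotients,
  which are continuous in \<open>t\<close>.\<close>

lemma continuous_on_deriv_of_bounded_family:
  fixes f :: "'a::metric_space \<Rightarrow> complex \<Rightarrow> complex"
  assumes "r > 0"
    and hol: "\<And>t. t \<in> T \<Longrightarrow> f t holomorphic_on ball \<xi> r"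
    and bound: "\<And>t z. t \<in> T \<Longrightarrow> z \<in> ball \<xi> r \<Longrightarrow> norm (f t z) \<le> C"
    and cont: "\<And>z. z \<in> ball \<xi> r \<Longrightarrow> continuous_on T (\<lambda>t. f t z)"
  shows "continuous_on (T \<times> ball \<xi> (r/2)) (\<lambda>(t, z). deriv (f t) z)"
proof -
  define D where "D = ball \<xi> (r/2)"
  have D: "D \<subseteq> ball \<xi> r" "open D" "convex D" using \<open>r > 0\<close> by (auto simp: D_def)
  define K where "K = 2 * \<bar>C\<bar> / (r/2)\<^sup>2"
  have K: "K \<ge> 0" by (simp add: K_def)
  have deriv2: "norm (deriv (deriv (f t)) z) \<le> K" if "t \<in> T" "z \<in> D" for t z
  proof -
    have sub: "cball z (r/2) \<subseteq> ball \<xi> r"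
    proof
      fix w assume "w \<in> cball z (r/2)"
      moreover have "dist \<xi> w \<le> dist \<xi> z + dist z w" by (rule dist_triangle)
      ultimately show "w \<in> ball \<xi> r" using that(2) by (auto simp: D_def)
    qed
    have "norm ((deriv ^^ 2) (f t) z) \<le> fact 2 * \<bar>C\<bar> / (r/2) ^ 2"
    proof (rule Cauchy_inequality)
      show "f t holomorphic_on ball z (r/2)"
        using hol[OF that(1)] sub ball_subset_cball by (meson holomorphic_on_subset order_trans)
      show "continuous_on (cball z (r/2)) (f t)"
        using hol[OF that(1)] sub holomorphic_on_imp_continuous_on holomorphic_on_subset by blast
      fix x assume "norm (z - x) = r/2"
      then have "x \<in> ball \<xi> r" using sub by (auto simp: dist_norm)
      then show "norm (f t x) \<le> \<bar>C\<bar>" using bound[OF that(1)] by fastforce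
    qed (use \<open>r > 0\<close> in auto)
    then show ?thesis by (simp add: K_def numeral_2_eq_2)
  qed
  have d1: "(f t has_field_derivative deriv (f t) z) (at z within D)"
    and d2: "(deriv (f t) has_field_derivative deriv (deriv (f t)) z) (at z within D)"
    if "t \<in> T" "z \<in> D" for t z
  proof -
    have "f t holomorphic_on D" using hol[OF that(1)] D(1) holomorphic_on_subset by blast
    then show "(f t has_field_derivative deriv (f t) z) (at z within D)"
      "(deriv (f t) has_field_derivative deriv (deriv (f t)) z) (at z within D)"
      using that D holomorphic_derivI holomorphic_deriv by blast+
  qed
  have taylor: "norm (f t w - f t z - deriv (f t) z * (w - z)) \<le> K * norm (w - z) ^ 2"
    if "t \<in> T" "z \<in> D" "w \<in> D" for t z w
  proof -
    have "norm ((deriv ^^ 0) (f t) w - (\<Sum>i\<le>1. (deriv ^^ i) (f t) z * (w - z) ^ i / fact i))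
        \<le> K * norm (w - z) ^ (Suc 1) / fact 1"
    proof (rule complex_Taylor[OF D(3)])
      fix i x assume "x \<in> D" "i \<le> (1::nat)"
      then have "i = 0 \<or> i = 1" by auto
      then show "((deriv ^^ i) (f t) has_field_derivative (deriv ^^ Suc i) (f t) x) (at x within D)"
        using d1 d2 that(1) \<open>x \<in> D\<close> by auto
    qed (use that deriv2 in auto)
    then show ?thesis by (simp add: algebra_simps numeral_2_eq_2)
  qed
  have cont_t: "continuous_on T (\<lambda>t. deriv (f t) z)" if z: "z \<in> D" for z
  proof (rule uniform_limit_theorem)
    have nearby: "\<forall>\<^sub>F w in at z. w \<in> D \<and> w \<noteq> z"
      using D(2) z unfolding eventually_at_topological by blast
    show "\<forall>\<^sub>F w in at z. continuous_on T (\<lambda>t. (f t w - f t z) / (w - z))"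
      using nearby
    proof eventually_elim
      case (elim w)
      then have "w \<in> ball \<xi> r" "z \<in> ball \<xi> r" using z D(1) by blast+
      then show ?case
        using elim by (intro continuous_on_divide continuous_on_diff cont continuous_on_const) auto
    qed
    show "uniform_limit T (\<lambda>w t. (f t w - f t z) / (w - z)) (\<lambda>t. deriv (f t) z) (at z)"
    proof (rule uniform_limitI)
      fix e :: real assume "e > 0"
      have "((\<lambda>w. K * norm (w - z)) \<longlongrightarrow> K * norm (z - z)) (at z)"
        by (intro tendsto_intros)
      then have "\<forall>\<^sub>F w in at z. K * norm (w - z) < e"
        using \<open>e > 0\<close> by (simp add: order_tendsto_iff)
      with nearby show "\<forall>\<^sub>F w in at z. \<forall>t\<in>T. dist ((f t w - f t z) / (w - z)) (deriv (f t) z) < e"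
      proof eventually_elim
        case (elim w)
        show ?case
        proof
          fix t assume t: "t \<in> T"
          have pos: "norm (w - z) > 0" using elim by simp
          have "dist ((f t w - f t z) / (w - z)) (deriv (f t) z)
              = norm ((f t w - f t z - deriv (f t) z * (w - z)) / (w - z))"
            using elim by (simp add: dist_norm diff_divide_distrib)
          also have "\<dots> \<le> K * norm (w - z)"
            using taylor[OF t z, of w] elim pos
            by (simp add: norm_divide divide_le_eq power2_eq_square mult.assoc)
          finally show "dist ((f t w - f t z) / (w - z)) (deriv (f t) z) < e"
            using elim by linarith
        qed
      qed
    qed
  qed simp
  have "local_lipschitz T D (\<lambda>t. deriv (f t))"
  proof (rule local_lipschitzI)
    have "K-lipschitz_on D (deriv (f t))" if "t \<in> T" for t
      using field_differentiable_bound[OF D(3) d2[OF that] deriv2[OF that]]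
      by (intro lipschitz_onI K) (simp add: dist_norm)
    then show "\<exists>u>0. \<exists>L. \<forall>t\<in>cball t u \<inter> T. L-lipschitz_on (cball x u \<inter> D) (deriv (f t))" for t x
      by (meson Int_iff lipschitz_on_subset Int_lower2 zero_less_one)
  qed
  then show ?thesis
    using continuous_on_TimesI cont_t unfolding D_def by blast
qed

section \<open>Solutions along the characteristics\<close>

text \<open>The function \<open>w \<mapsto> e\<^sup>a\<^sup>t Y(t, e\<^sup>2\<^sup>a\<^sup>t w)\<close>, that is, the solution at time \<open>t\<close>
  transported back along the characteristics to time \<open>0\<close> and freed of its decay factor.\<close>

definition along_flow :: "real \<Rightarrow> (real \<Rightarrow> complex \<Rightarrow> complex) \<Rightarrow> real \<Rightarrow> complex \<Rightarrow> complex" where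
  "along_flow a Y t = (\<lambda>w. of_real (exp (a * t)) * Y t (of_real (exp (2 * a * t)) * w))"

lemma along_flow_inverse:
  "Y t z = of_real (exp (- a * t)) * along_flow a Y t (of_real (exp (- 2 * a * t)) * z)"
proof -
  have "complex_of_real (exp (- a * t)) * of_real (exp (a * t)) = 1"
    "complex_of_real (exp (2 * a * t)) * of_real (exp (- 2 * a * t)) = 1"
    by (simp_all flip: of_real_mult exp_add)
  then show ?thesis unfolding along_flow_def by (simp flip: mult.assoc)
qed

text \<open>A common value of \<open>along_flow a Y\<close> on \<open>S\<close> passes to limit points of \<open>S\<close>. The moving argument
  in \<open>along_flow\<close> would call for joint continuity of \<open>Y\<close>; constancy avoids this, since it expresses
  \<open>Y\<close> on \<open>S\<close> through the single continuous function \<open>F\<close>, and then continuity of \<open>Y\<close> in time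
  at each fixed \<open>z\<close> is enough.\<close>

lemma along_flow_limit:
  assumes const: "\<And>\<tau>. \<tau> \<in> S \<Longrightarrow> along_flow a Y \<tau> = F"
    and F: "continuous_on UNIV F"
    and lim: "at s within S \<noteq> bot"
    and cont: "\<And>z. ((\<lambda>\<tau>. Y \<tau> z) \<longlongrightarrow> Y s z) (at s within S)"
  shows "along_flow a Y s = F"
proof
  fix w
  define z where "z = complex_of_real (exp (2 * a * s)) * w"
  have "continuous_on UNIV (\<lambda>\<tau>. of_real (exp (- a * \<tau>)) * F (of_real (exp (- 2 * a * \<tau>)) * z))"
    by (intro continuous_intros continuous_on_compose2[OF F]) auto
  then have "((\<lambda>\<tau>. of_real (exp (- a * \<tau>)) * F (of_real (exp (- 2 * a * \<tau>)) * z)) \<longlongrightarrow>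
      of_real (exp (- a * s)) * F (of_real (exp (- 2 * a * s)) * z)) (at s within S)"
    by (auto simp: continuous_on_def intro: tendsto_within_subset)
  moreover have "\<forall>\<^sub>F \<tau> in at s within S.
      of_real (exp (- a * \<tau>)) * F (of_real (exp (- 2 * a * \<tau>)) * z) = Y \<tau> z"
    unfolding eventually_at_filter
    by (intro always_eventually allI impI) (metis along_flow_inverse const)
  ultimately have "((\<lambda>\<tau>. Y \<tau> z) \<longlongrightarrow>
      of_real (exp (- a * s)) * F (of_real (exp (- 2 * a * s)) * z)) (at s within S)"
    by (simp add: tendsto_cong)
  then have "Y s z = of_real (exp (- a * s)) * F (of_real (exp (- 2 * a * s)) * z)"
    using tendsto_unique[OF lim cont] by blast
  moreover have "complex_of_real (exp (- 2 * a * s)) * z = w"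
    unfolding z_def by (simp flip: of_real_mult exp_add mult.assoc)
  moreover have "complex_of_real (exp (a * s)) * of_real (exp (- a * s)) = 1"
    by (simp flip: of_real_mult exp_add)
  moreover have "along_flow a Y s w = of_real (exp (a * s)) * Y s z"
    by (simp add: along_flow_def z_def)
  ultimately show "along_flow a Y s w = F w"
    by (metis mult.assoc mult_1)
qed

text \<open>Separately regular solutions for positive times, without any condition at time \<open>0\<close>.\<close>

locale euler_heat_solution =
  fixes a :: real and Y :: "real \<Rightarrow> complex \<Rightarrow> complex"
  assumes a_pos: "a > 0"
    and holomorphic: "\<And>t. t > 0 \<Longrightarrow> Y t holomorphic_on UNIV"
    and pde: "\<And>t z. t > 0 \<Longrightarrow> ((\<lambda>s. Y s z) has_vector_derivative euler_op a (Y t) z) (at t)"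
begin

lemma continuous_on_time: "continuous_on {0<..} (\<lambda>t. Y t z)"
  by (intro continuous_at_imp_continuous_on ballI has_vector_derivative_continuous[OF pde]) simp

lemma along_flow_holomorphic: "t > 0 \<Longrightarrow> along_flow a Y t holomorphic_on UNIV"
  unfolding along_flow_def
  by (intro holomorphic_intros holomorphic_on_compose_gen[OF _ holomorphic, unfolded o_def]) auto

text \<open>With \<open>\<partial>Y/\<partial>z\<close> jointly continuous, \<open>Y\<close> is differentiable in \<open>(t, z)\<close> jointly, and the
  equation makes the terms of the chain rule cancel.\<close>

lemma along_flow_has_derivative_0:
  assumes T: "T = {c<..<d}" "c \<ge> 0" "t \<in> T"
    and deriv_cont: "continuous_on (T \<times> D) (\<lambda>(t, z). deriv (Y t) z)"
    and D: "open D" "convex D" "of_real (exp (2 * a * t)) * w \<in> D"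
  shows "((\<lambda>s. along_flow a Y s w) has_vector_derivative 0) (at t)"
proof -
  define \<zeta> where "\<zeta> = (\<lambda>s. complex_of_real (exp (2 * a * s)) * w)"
  have T': "open T" "\<And>s. s \<in> T \<Longrightarrow> s > 0" using T by auto
  have \<zeta>t: "\<zeta> t \<in> D" using D(3) by (simp add: \<zeta>_def)
  have open_TD: "open (T \<times> D)" using T' D by (intro open_Times) auto
  have "((\<lambda>(s, z). Y s z) has_derivative
      (\<lambda>(h, k). h *\<^sub>R euler_op a (Y t) (\<zeta> t) + blinfun_mult_right (deriv (Y t) (\<zeta> t)) k))
      (at (t, \<zeta> t) within T \<times> D)"
  proof (rule has_derivative_partialsI[where fy = "\<lambda>s z. blinfun_mult_right (deriv (Y s) z)"])
    show "((\<lambda>s. Y s (\<zeta> t)) has_derivative (\<lambda>h. h *\<^sub>R euler_op a (Y t) (\<zeta> t))) (at t within T)"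
      using pde[OF T'(2)[OF T(3)], of "\<zeta> t"]
      unfolding has_vector_derivative_def by (rule has_derivative_at_withinI)
    show "((\<lambda>z. Y s z) has_derivative blinfun_apply (blinfun_mult_right (deriv (Y s) z)))
        (at z within D)" if "s \<in> T" "z \<in> D" for s z
      using holomorphic_derivI[OF holomorphic[OF T'(2)[OF that(1)]] open_UNIV UNIV_I, of z]
      by (simp add: has_field_derivative_def has_derivative_at_withinI)
    have "continuous_on (T \<times> D) (\<lambda>p. blinfun_mult_right (case p of (t, z) \<Rightarrow> deriv (Y t) z))"
      using bounded_linear_blinfun_mult_right deriv_cont by (rule bounded_linear.continuous_on)
    then show "continuous (at (t, \<zeta> t) within T \<times> D)
        (\<lambda>(t, z). blinfun_mult_right (deriv (Y t) z))"
      using T(3) \<zeta>t by (auto simp: continuous_on_eq_continuous_within case_prod_unfold)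
  qed (use \<zeta>t D in auto)
  then have total: "((\<lambda>(s, z). Y s z) has_derivative
      (\<lambda>(h, k). h *\<^sub>R euler_op a (Y t) (\<zeta> t) + deriv (Y t) (\<zeta> t) * k)) (at (t, \<zeta> t))"
    using at_within_open[OF _ open_TD] T(3) \<zeta>t by simp
  have "((\<lambda>s. (s, \<zeta> s)) has_derivative (\<lambda>h. (h, h *\<^sub>R (2 * a * \<zeta> t)))) (at t)"
    unfolding \<zeta>_def
    by (auto intro!: derivative_eq_intros simp: scaleR_conv_of_real algebra_simps)
  from has_derivative_compose[OF this total]
  have along: "((\<lambda>s. Y s (\<zeta> s)) has_vector_derivative - a * Y t (\<zeta> t)) (at t)"
    by (simp add: has_vector_derivative_def euler_op_def scaleR_conv_of_real algebra_simps)
  have "((\<lambda>s. complex_of_real (exp (a * s))) has_vector_derivative a * exp (a * t)) (at t)"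
    by (auto intro!: derivative_eq_intros has_vector_derivative_of_real)
  from has_vector_derivative_mult[OF this along]
  show ?thesis by (simp add: along_flow_def \<zeta>_def algebra_simps)
qed

text \<open>A bound on a disc of any radius about \<open>0\<close> gives equality on the whole plane. The centre \<open>0\<close>
  matters: it is the fixed point of the flow, so characteristics starting close to it are
  still in the disc at time \<open>d\<close>.\<close>

lemma along_flow_constant_if_bounded:
  assumes "0 \<le> c" and "r > 0"
    and bound: "\<And>t z. c < t \<Longrightarrow> t < d \<Longrightarrow> z \<in> ball 0 r \<Longrightarrow> norm (Y t z) \<le> C"
    and st: "s \<in> {c<..<d}" "t \<in> {c<..<d}"
  shows "along_flow a Y s = along_flow a Y t"
proof -
  define T where "T = {c<..<d}"
  define \<rho> where "\<rho> = exp (- (2 * a * d)) * (r / 2)"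
  have \<rho>: "\<rho> > 0" using \<open>r > 0\<close> by (simp add: \<rho>_def)
  have T_pos: "\<tau> > 0" if "\<tau> \<in> T" for \<tau> using that \<open>0 \<le> c\<close> by (simp add: T_def)
  have deriv_cont: "continuous_on (T \<times> ball 0 (r/2)) (\<lambda>(t, z). deriv (Y t) z)"
  proof (rule continuous_on_deriv_of_bounded_family[OF \<open>r > 0\<close>, where C = C])
    show "continuous_on T (\<lambda>t. Y t z)" for z
      using T_pos by (intro continuous_on_subset[OF continuous_on_time]) auto
  qed (use T_pos holomorphic bound in \<open>auto simp: T_def intro: holomorphic_on_subset\<close>)
  \<comment> \<open>For \<open>|w| < \<rho>\<close> the characteristic through \<open>w\<close> stays in the disc of radius \<open>r/2\<close> until time
    \<open>d\<close>.\<close>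
  have local: "along_flow a Y s w = along_flow a Y t w" if w: "w \<in> ball 0 \<rho>" for w
  proof (rule has_derivative_zero_unique[where f = "\<lambda>\<tau>. along_flow a Y \<tau> w"])
    show "convex T" by (simp add: T_def)
    show "s \<in> T" "t \<in> T" using st by (auto simp: T_def)
    fix \<tau> assume \<tau>: "\<tau> \<in> T"
    have "exp (2 * a * \<tau>) * norm w \<le> exp (2 * a * d) * norm w"
      using \<tau> a_pos by (intro mult_right_mono) (auto simp: T_def)
    also have "\<dots> < exp (2 * a * d) * \<rho>" using w by simp
    also have "\<dots> = r / 2" by (simp add: \<rho>_def exp_minus field_simps)
    finally have "of_real (exp (2 * a * \<tau>)) * w \<in> ball 0 (r/2)"
      by (simp add: norm_mult)
    then have "((\<lambda>s. along_flow a Y s w) has_vector_derivative 0) (at \<tau>)"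
      using along_flow_has_derivative_0[OF T_def \<open>0 \<le> c\<close> \<tau> deriv_cont] by simp
    then show "((\<lambda>s. along_flow a Y s w) has_derivative (\<lambda>h. 0)) (at \<tau> within T)"
      by (simp add: has_vector_derivative_def has_derivative_at_withinI)
  qed
  have "along_flow a Y s w = along_flow a Y t w" for w
  proof (rule analytic_continuation_open[of "ball 0 \<rho>" UNIV "along_flow a Y s" "along_flow a Y t"])
    show "along_flow a Y s holomorphic_on UNIV" "along_flow a Y t holomorphic_on UNIV"
      using st T_pos along_flow_holomorphic by (auto simp: T_def)
  qed (use \<rho> local in auto)
  then show ?thesis by blast
qed

section \<open>Absence of irregular times\<close>

text \<open>The positive times near which \<open>along_flow a Y\<close> fails to be constant.\<close>

definition "irregular_times = {t. t > 0 \<and> \<not> (\<forall>\<^sub>F s in nhds t. along_flow a Y s = along_flow a Y t)}"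

lemma closedin_irregular_times: "closedin (top_of_set {0<..}) irregular_times"
proof -
  define G where "G = {t. \<forall>\<^sub>F s in nhds t. along_flow a Y s = along_flow a Y t}"
  have "open G"
  proof (subst open_subopen, intro ballI)
    fix t assume "t \<in> G"
    then obtain U where U: "open U" "t \<in> U" "\<And>s. s \<in> U \<Longrightarrow> along_flow a Y s = along_flow a Y t"
      by (auto simp: G_def eventually_nhds)
    have "U \<subseteq> G"
    proof
      fix s assume "s \<in> U"
      then have "\<forall>x\<in>U. along_flow a Y x = along_flow a Y s" by (metis U(3))
      then show "s \<in> G"
        using U(1) \<open>s \<in> U\<close> unfolding G_def eventually_nhds by blast
    qed
    then show "\<exists>T. open T \<and> t \<in> T \<and> T \<subseteq> G" using U by blast
  qed
  moreover have "irregular_times = {0<..} \<inter> - G"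
    by (auto simp: irregular_times_def G_def)
  ultimately show ?thesis by (metis closedin_closed closed_Compl)
qed

lemma along_flow_constant_on_regular:
  assumes "connected S" "S \<subseteq> {0<..} - irregular_times" "s \<in> S" "t \<in> S"
  shows "along_flow a Y s = along_flow a Y t"
proof (rule connected_local_const[OF assms(1,3,4)], intro ballI)
  fix \<tau> assume "\<tau> \<in> S"
  then have "\<forall>\<^sub>F s in nhds \<tau>. along_flow a Y s = along_flow a Y \<tau>"
    using assms(2) by (auto simp: irregular_times_def)
  then show "\<forall>\<^sub>F s in at \<tau> within S. along_flow a Y \<tau> = along_flow a Y s"
    unfolding eventually_at_filter by (rule eventually_mono) simp
qed

text \<open>Let \<open>s\<close> be the irregular time nearest to \<open>t\<close> on the way to \<open>q\<close>. The open segment between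
  \<open>t\<close> and \<open>s\<close> contains only regular times, and the constant value there extends to both ends.\<close>

lemma along_flow_eq_at_nearest_irregular_time:
  assumes "t > 0" "q \<in> irregular_times"
  obtains s where "s \<in> irregular_times" "s \<in> closed_segment t q" "along_flow a Y t = along_flow a Y s"
proof (cases "t \<in> irregular_times")
  case True
  then show ?thesis using that[of t] by simp
next
  case False
  have q: "q > 0" using assms(2) by (simp add: irregular_times_def)
  define L where "L = irregular_times \<inter> closed_segment t q"
  have seg_pos: "closed_segment t q \<subseteq> {0<..}"
    using q assms(1) by (auto simp: closed_segment_eq_real_ivl split: if_splits)
  have "closed L"
  proof -
    obtain C where "closed C" "irregular_times = {0<..} \<inter> C"
      using closedin_irregular_times by (auto simp: closedin_closed)
    moreover from this have "L = C \<inter> closed_segment t q" using seg_pos by (auto simp: L_def)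
    ultimately show ?thesis by (simp add: closed_Int)
  qed
  moreover have "L \<noteq> {}" using assms(2) by (auto simp: L_def)
  ultimately obtain s where s: "s \<in> L" and nearest: "\<And>x. x \<in> L \<Longrightarrow> dist t s \<le> dist t x"
    using distance_attains_inf by blast
  have "s \<noteq> t" using s False by (auto simp: L_def)
  define S where "S = open_segment t s"
  have S_seg: "S \<subseteq> closed_segment t q"
    using s unfolding S_def L_def
    by (metis IntD2 segment_open_subset_closed ends_in_segment(1) subset_closed_segment order_trans)
  have S_regular: "S \<subseteq> {0<..} - irregular_times"
  proof
    fix x assume x: "x \<in> S"
    then have "dist t x < dist t s"
      by (auto simp: S_def open_segment_eq_real_ivl dist_real_def split: if_splits)
    then have "x \<notin> L" using nearest by fastforce
    then show "x \<in> {0<..} - irregular_times" using x S_seg seg_pos by (auto simp: L_def)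
  qed
  have "S \<noteq> {}" using \<open>s \<noteq> t\<close> by (simp add: S_def)
  then obtain \<tau> where \<tau>: "\<tau> \<in> S" by blast
  define F where "F = along_flow a Y \<tau>"
  have const: "along_flow a Y x = F" if "x \<in> S" for x
    unfolding F_def using S_regular \<tau> that
    by (intro along_flow_constant_on_regular[of S]) (auto simp: S_def intro!: convex_connected)
  have F_cont: "continuous_on UNIV F"
    unfolding F_def using \<tau> S_regular
    by (intro holomorphic_on_imp_continuous_on along_flow_holomorphic) auto
  have endpoint: "along_flow a Y x = F" if x: "x \<in> {t, s}" for x
  proof (rule along_flow_limit[where S = S])
    have "x \<in> closure S" using x \<open>s \<noteq> t\<close> by (auto simp: S_def closure_open_segment)
    moreover have "x \<notin> S" using x by (auto simp: S_def open_segment_def)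
    ultimately have "x islimpt S" by (auto simp: closure_def)
    then show "at x within S \<noteq> bot" by (simp add: trivial_limit_within)
    have "x > 0" using x s seg_pos assms(1) by (auto simp: L_def)
    then have "continuous (at x) (\<lambda>\<tau>. Y \<tau> z)" for z
      using pde has_vector_derivative_continuous by blast
    then show "((\<lambda>\<tau>. Y \<tau> z) \<longlongrightarrow> Y x z) (at x within S)" for z
      by (meson continuous_at tendsto_within_subset subset_UNIV)
  qed (use const F_cont in auto)
  show ?thesis
    using that[of s] s endpoint[of t] endpoint[of s] by (simp add: L_def)
qed

lemma no_irregular_times: "irregular_times = {}"
proof (rule ccontr)
  assume ne: "irregular_times \<noteq> {}"
  have "completely_metrizable_space (top_of_set {0::real<..})"
    by (intro completely_metrizable_space_openin completely_metrizable_space_euclidean)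
      (simp flip: open_openin)
  from completely_metrizable_space_closedin[OF this closedin_irregular_times]
  have P: "completely_metrizable_space (top_of_set irregular_times)"
    by (simp add: subtopology_subtopology irregular_times_def Int_absorb1 Int_def conj_ac)
  have pos: "irregular_times \<subseteq> {0<..}" by (auto simp: irregular_times_def)
  obtain U B where U: "open U" "U \<inter> irregular_times \<noteq> {}"
    and B: "\<And>t z. t \<in> U \<inter> irregular_times \<Longrightarrow> z \<in> cball 0 1 \<Longrightarrow> norm (Y t z) \<le> B"
  proof (rule uniformly_bounded_on_relatively_open_subset[OF P ne, of "cball 0 1" Y])
    show "continuous_on irregular_times (\<lambda>t. Y t z)" for z
      using continuous_on_time pos continuous_on_subset by blast
    show "\<exists>B. \<forall>z\<in>cball 0 1. norm (Y t z) \<le> B" if "t \<in> irregular_times" for t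
    proof -
      have "continuous_on (cball 0 1) (Y t)"
        using holomorphic that pos holomorphic_on_imp_continuous_on holomorphic_on_subset
        by (metis greaterThan_iff subsetD subset_UNIV)
      then have "bounded (Y t ` cball 0 1)"
        by (intro compact_imp_bounded compact_continuous_image compact_cball)
      then show ?thesis by (auto simp: bounded_iff)
    qed
  qed blast
  then obtain q where q: "q \<in> U" "q \<in> irregular_times" by blast
  have "open (U \<inter> {0<..})" using U(1) by auto
  then obtain e where e: "e > 0" "ball q e \<subseteq> U \<inter> {0<..}"
    using q pos by (metis IntI open_contains_ball subsetD)
  define c d where "c = q - e / 2" and "d = q + e / 2"
  have cd: "c < q" "q < d" "d = c + e" using e by (auto simp: c_def d_def field_simps)
  have sub: "{c..d} \<subseteq> U \<inter> {0<..}"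
    using e by (intro order_trans[OF _ e(2)]) (auto simp: c_def d_def dist_real_def)
  have "c \<in> {c..d}" using cd by simp
  then have c_pos: "c > 0" using sub by blast
  \<comment> \<open>A time \<open>t\<close> in \<open>(c, d)\<close> is compared below with an irregular \<open>s\<close> in \<open>(c, d)\<close>, where possibly
    \<open>s > t\<close>. Moving from \<open>t\<close> to \<open>s\<close> then dilates by less than \<open>exp (2 * a * e)\<close>,
    so the disc of radius \<open>r\<close> is carried into the unit disc.\<close>
  define r where "r = exp (- (2 * a * e))"
  have bound: "norm (Y t z) \<le> exp (a * e) * \<bar>B\<bar>" if t: "c < t" "t < d" and z: "z \<in> ball 0 r" for t z
  proof -
    obtain s where s: "s \<in> irregular_times" "s \<in> closed_segment t q"
      and eq: "along_flow a Y t = along_flow a Y s"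
      using along_flow_eq_at_nearest_irregular_time[of t q] t c_pos q by auto
    have s_cd: "c < s" "s < d"
      using s(2) t cd by (auto simp: closed_segment_eq_real_ivl split: if_splits)
    then have close: "s - t < e" "\<bar>s - t\<bar> < e" using t cd by auto
    define z' where "z' = complex_of_real (exp (2 * a * s)) * (of_real (exp (- 2 * a * t)) * z)"
    have "Y t z = of_real (exp (- a * t)) * (of_real (exp (a * s)) * Y s z')"
      using along_flow_inverse[of Y t z a] unfolding eq by (simp only: along_flow_def z'_def)
    then have "norm (Y t z) = exp (- a * t) * (exp (a * s) * norm (Y s z'))"
      by (simp only: norm_mult norm_of_real abs_exp_cancel)
    also have "\<dots> = exp (a * (s - t)) * norm (Y s z')"
      by (simp add: right_diff_distrib exp_diff exp_minus field_simps)
    also have "\<dots> \<le> exp (a * e) * \<bar>B\<bar>"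
    proof (intro mult_mono)
      show "exp (a * (s - t)) \<le> exp (a * e)" using close a_pos by simp
      have "norm z' = exp (2 * a * s) * (exp (- 2 * a * t) * norm z)"
        by (simp only: z'_def norm_mult norm_of_real abs_exp_cancel)
      also have "\<dots> = exp (2 * a * (s - t)) * norm z"
        by (simp add: right_diff_distrib exp_diff exp_minus field_simps)
      also have "\<dots> \<le> exp (2 * a * e) * r"
        using close a_pos z by (intro mult_mono) auto
      also have "\<dots> = 1" by (simp add: r_def flip: exp_add)
      finally have "z' \<in> cball 0 1" by simp
      moreover have "s \<in> {c..d}" using s_cd by simp
      ultimately have "norm (Y s z') \<le> B" using B s(1) sub by blast
      then show "norm (Y s z') \<le> \<bar>B\<bar>" by simp
    qed auto
    finally show ?thesis .
  qed
  have "along_flow a Y s = along_flow a Y q" if "s \<in> {c<..<d}" for s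
    by (rule along_flow_constant_if_bounded[OF _ _ bound]) (use that c_pos cd in \<open>auto simp: r_def\<close>)
  then have "\<forall>\<^sub>F s in nhds q. along_flow a Y s = along_flow a Y q"
    unfolding eventually_nhds
    using cd(1,2) by (metis greaterThanLessThan_iff open_greaterThanLessThan)
  then show False using q(2) by (simp add: irregular_times_def)
qed

lemma along_flow_constant: "s > 0 \<Longrightarrow> t > 0 \<Longrightarrow> along_flow a Y s = along_flow a Y t"
  by (rule along_flow_constant_on_regular[of "{0<..}"]) (auto simp: no_irregular_times)

lemma along_flow_eq_initial:
  assumes cont: "\<And>z. continuous_on {0..} (\<lambda>t. Y t z)" and "t > 0"
  shows "along_flow a Y t = Y 0"
proof -
  have "along_flow a Y 0 = along_flow a Y t"
  proof (rule along_flow_limit[where S = "{0<..}"])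
    show "((\<lambda>\<tau>. Y \<tau> z) \<longlongrightarrow> Y 0 z) (at 0 within {0<..})" for z
      using cont[of z] by (auto simp: continuous_on_def intro: tendsto_within_subset)
    show "continuous_on UNIV (along_flow a Y t)"
      using along_flow_holomorphic[OF \<open>t > 0\<close>] by (rule holomorphic_on_imp_continuous_on)
    show "along_flow a Y \<tau> = along_flow a Y t" if "\<tau> \<in> {0<..}" for \<tau>
      using that \<open>t > 0\<close> by (intro along_flow_constant) auto
  qed simp
  moreover have "along_flow a Y 0 = Y 0" by (simp add: along_flow_def)
  ultimately show ?thesis by metis
qed

end

section \<open>Existence and uniqueness\<close>

lemma heat_solution_unique:
  assumes "a > 0" "heat_solution a Y0 Y" "t \<ge> 0"
  shows "Y t z = of_real (exp (- a * t)) * Y0 (of_real (exp (- 2 * a * t)) * z)"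
proof (cases "t = 0")
  case True
  then show ?thesis using assms by (simp add: heat_solution_def)
next
  case False
  interpret euler_heat_solution a Y
    using assms by unfold_locales (auto simp: heat_solution_def)
  have "along_flow a Y t = Y 0"
    using assms False by (intro along_flow_eq_initial) (auto simp: heat_solution_def)
  moreover have "Y 0 = Y0" using assms by (auto simp: heat_solution_def)
  ultimately show ?thesis using along_flow_inverse[of Y t z a] by simp
qed

lemma heat_solution_exists:
  assumes hol: "Y0 holomorphic_on UNIV"
    and Y: "\<And>t z. t \<ge> 0 \<Longrightarrow> Y t z = of_real (exp (- a * t)) * Y0 (of_real (exp (- 2 * a * t)) * z)"
  shows "heat_solution a Y0 Y"
proof -
  define V where "V = (\<lambda>t z. complex_of_real (exp (- a * t)) * Y0 (of_real (exp (- 2 * a * t)) * z))"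
  have YV: "Y t = V t" if "t \<ge> 0" for t
    by (rule ext) (simp only: Y[OF that] V_def)
  have Y0': "(Y0 has_field_derivative deriv Y0 z) (at z)" for z
    using holomorphic_derivI[OF hol open_UNIV] by simp
  have "V t holomorphic_on UNIV" for t
    unfolding V_def
    by (intro holomorphic_intros holomorphic_on_compose_gen[OF _ hol, unfolded o_def]) auto
  moreover have V': "((\<lambda>s. V s z) has_vector_derivative euler_op a (V t) z) (at t)" for t z
  proof -
    have dz: "(V t has_field_derivative
        exp (- a * t) * (deriv Y0 (of_real (exp (- 2 * a * t)) * z) * exp (- 2 * a * t))) (at z)"
      unfolding V_def
      by (intro DERIV_cmult DERIV_chain2[where f = Y0, OF Y0']) (auto intro!: derivative_eq_intros)
    have "((\<lambda>s. complex_of_real (exp (- 2 * a * s)) * z) has_vector_derivative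
        of_real (- 2 * a * exp (- 2 * a * t)) * z) (at t)"
      by (auto intro!: derivative_eq_intros has_vector_derivative_of_real)
    from field_vector_diff_chain_at[OF this Y0']
    have inner: "((\<lambda>s. Y0 (complex_of_real (exp (- 2 * a * s)) * z)) has_vector_derivative
        of_real (- 2 * a * exp (- 2 * a * t)) * z * deriv Y0 (of_real (exp (- 2 * a * t)) * z)) (at t)"
      by (simp add: o_def)
    have "((\<lambda>s. complex_of_real (exp (- a * s))) has_vector_derivative of_real (- a * exp (- a * t))) (at t)"
      by (auto intro!: derivative_eq_intros has_vector_derivative_of_real)
    from has_vector_derivative_mult[OF this inner]
    show ?thesis
      unfolding euler_op_def DERIV_imp_deriv[OF dz] unfolding V_def
      by (rule has_vector_derivative_eq_rhs) (simp add: algebra_simps)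
  qed
  moreover have "continuous_on {0..} (\<lambda>t. V t z)" for z
    by (intro continuous_at_imp_continuous_on ballI has_vector_derivative_continuous[OF V'])
  ultimately show ?thesis
    unfolding heat_solution_def
  proof (intro conjI allI impI)
    show "((\<lambda>s. Y s z) has_vector_derivative euler_op a (Y t) z) (at t)" if "t > 0" for t z
      unfolding YV[OF less_imp_le[OF that]]
      by (rule has_vector_derivative_transform_within_open[OF V', where S = "{0<..}"])
        (use that in \<open>auto simp: YV\<close>)
    show "continuous_on {0..} (\<lambda>t. Y t z)" if "\<And>z. continuous_on {0..} (\<lambda>t. V t z)" for z
      using that[of z] by (rule continuous_on_eq) (auto simp: YV)
  qed (auto simp: YV V_def)
qed

theorem theorem4p2:
  fixes a :: real and Y0 :: "complex \<Rightarrow> complex" and Y :: "real \<Rightarrow> complex \<Rightarrow> complex"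
  assumes "a > 0" and "Y0 \<in> fock_space (a / 2)"
  shows "heat_solution a Y0 Y \<longleftrightarrow>
    (\<forall>t\<ge>0. \<forall>z. Y t z = of_real (exp (- a * t)) * Y0 (of_real (exp (- 2 * a * t)) * z))"
proof
  show "\<forall>t\<ge>0. \<forall>z. Y t z = of_real (exp (- a * t)) * Y0 (of_real (exp (- 2 * a * t)) * z)"
    if "heat_solution a Y0 Y"
    using heat_solution_unique[OF assms(1) that] by blast
  show "heat_solution a Y0 Y"
    if "\<forall>t\<ge>0. \<forall>z. Y t z = of_real (exp (- a * t)) * Y0 (of_real (exp (- 2 * a * t)) * z)"
    using heat_solution_exists[of Y0 Y a] assms(2) that by (auto simp: fock_space_def)
qed

end
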